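(* Let $0<s<1/2$ and let $$K_{-s}(m)=\frac{1}{\Gamma(s)}\int_0^\infty e^{-2t}I_m(2t)\,\frac{dt}{t^{1-s}},\qquad m\in\mathbb{Z}.$$ Then $$K_{-s}(m)=\frac{4^{-s}\Gamma(1/2-s)\Gamma(|m|+s)}{\sqrt{\pi}\,\Gamma(s)\Gamma(|m|+1-s)}\ \text{ for } m\in\mathbb{Z}\setminus\{0\},\qquad K_{-s}(0)=\frac{4^{-s}\Gamma(1/2-s)}{\sqrt{\pi}\,\Gamma(1-s)}.$$ Moreover, there exists a positive constant $C_s$ such that, for all $m\in\mathbb{Z}\setminus\{0\}$, $$\Big|K_{-s}(m)-\frac{c_{-s}}{|m|^{1-2s}}\Big|\le\frac{C_s}{|m|^{2-2s}},\qquad\text{where } c_{-s}=\frac{4^{-s}\Gamma(1/2-s)}{\sqrt{\pi}\,\Gamma(s)}.$$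
   Context: $I_m$ denotes the modified Bessel function of the first kind of order $m\in\mathbb{Z}$. $K_{-s}$ is the convolution kernel of the fractional discrete integral $(-\Delta_h)^{-s}f_j=\frac{1}{\Gamma(s)}\int_0^\infty e^{t\Delta_h}f_j\frac{dt}{t^{1-s}}=h^{2s}\sum_{m\in\mathbb{Z}}K_{-s}(j-m)f_m$, where $e^{t\Delta_h}$ is the heat semigroup of the discrete Laplacian $\Delta_hu_j=h^{-2}(u_{j+1}-2u_j+u_{j-1})$. *)

theory Defs
  imports "HOL-Analysis.Analysis"
begin

text \<open>
  Modified Bessel function of the first kind of integer order \<open>m\<close>, by its power series.
  The reciprocal Gamma function \<open>rGamma\<close> vanishes at the non-positive integers, so for \<open>m < 0\<close> the
  terms with \<open>k < -m\<close> drop out, and every remaining exponent \<open>2 * k + m\<close> is non-negative.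
\<close>

definition bessel_I :: "int \<Rightarrow> real \<Rightarrow> real" where
  "bessel_I m x = (\<Sum>k. rGamma (of_int (int k + m + 1)) / fact k * (x / 2) powi (2 * int k + m))"

text \<open>
  \<open>frac_kernel s\<close> is the kernel \<open>K\<^bsub>-s\<^esub>\<close> of the fractional discrete integral,
  and \<open>frac_const s\<close> is \<open>c\<^bsub>-s\<^esub>\<close>.
\<close>

definition frac_kernel :: "real \<Rightarrow> int \<Rightarrow> real" where
  "frac_kernel s m =
     1 / Gamma s * (LINT t:{0<..}|lborel. exp (- (2 * t)) * bessel_I m (2 * t) / t powr (1 - s))"

definition frac_const :: "real \<Rightarrow> real" where
  "frac_const s = 4 powr (- s) * Gamma (1 / 2 - s) / (sqrt pi * Gamma s)"

end

theory Submission imports Defs begin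

text \<open>
  All terms of the power series of \<open>I\<^sub>m\<close> are nonnegative on the positive half-line, so the integral
  that defines the kernel may be taken term by term. With \<open>N = \<bar>m\<bar>\<close> each term contributes a Gamma
  integral, and the kernel times \<open>\<Gamma>(s)\<close> becomes the series over \<open>k\<close> of
  \<open>\<Gamma>(2k + N + s) / (2 powr (2k + N + s) * k! * (k + N)!)\<close>.

  By Legendre's duplication formula \<open>\<Gamma>(2k + N + s)\<close> is, up to a power of 2 that cancels the one in
  the denominator, the product \<open>\<Gamma>(k + a) \<Gamma>(k + a + 1/2)\<close> with \<open>a = (N + s) / 2\<close>. The series
  is therefore a hypergeometric series at the point 1 with parameters \<open>a\<close>, \<open>a + 1/2\<close> and
  \<open>c = N + 1\<close>. It converges exactly because \<open>c - a - (a + 1/2) = 1/2 - s\<close> is positive, and Gauss's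
  theorem \<open>gauss_hypergeometric_sum\<close> evaluates it; the duplication formula, used backwards, turns
  the value into the closed form of \<open>frac_kernel_eq\<close>. For \<open>m = 0\<close> the factor \<open>\<Gamma>(s)\<close> cancels.

  The asymptotics compare \<open>\<Gamma>(N + s) / \<Gamma>(N + 1 - s)\<close> with \<open>N powr (2 * s - 1)\<close>. Logarithmic convexity
  of \<open>\<Gamma>\<close> pins both \<open>\<Gamma>(N + s)\<close> and \<open>\<Gamma>(N + 1 - s)\<close> between explicit multiples of \<open>\<Gamma>(N)\<close>, with
  a relative error of order \<open>1/N\<close> and constant 1 (\<open>Gamma_ratio_bounds\<close>). Hence \<open>c\<^bsub>-s\<^esub>\<close> itself serves
  as the constant \<open>C\<^sub>s\<close>.
\<close>

section \<open>Duplication and ratio estimates for the real Gamma function\<close>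

lemma Gamma_legendre_duplication_real:
  fixes x :: real
  assumes "x > 0"
  shows "Gamma x * Gamma (x + 1 / 2) = 2 powr (1 - 2 * x) * sqrt pi * Gamma (2 * x)"
proof -
  have nonpole: "complex_of_real y \<notin> \<int>\<^sub>\<le>\<^sub>0" if "y > 0" for y
    using that by (auto elim!: nonpos_Ints_cases simp: complex_eq_iff)
  have "complex_of_real (Gamma x * Gamma (x + 1 / 2)) =
          Gamma (of_real x) * Gamma (of_real x + 1 / 2)"
    using Gamma_complex_of_real[of "x + 1/2"] by (simp add: Gamma_complex_of_real)
  also have "\<dots> = exp ((1 - 2 * of_real x) * of_real (ln 2)) * of_real (sqrt pi) * Gamma (2 * of_real x)"
    using nonpole[of x] nonpole[of "x + 1/2"] assms by (intro Gamma_legendre_duplication) auto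
  also have "\<dots> = of_real (exp ((1 - 2 * x) * ln 2) * sqrt pi * Gamma (2 * x))"
    using Gamma_complex_of_real[of "2 * x"] by (simp flip: exp_of_real)
  finally show ?thesis
    by (simp add: powr_def flip: of_real_eq_iff [where 'a = complex])
qed

lemma Gamma_log_convex_mult:
  fixes x y u :: real
  assumes "x > 0" "y > 0" "0 \<le> u" "u \<le> 1"
  shows "Gamma ((1 - u) * x + u * y) \<le> Gamma x powr (1 - u) * Gamma y powr u"
proof -
  have pos: "(1 - u) * x + u * y > 0"
    using assms by (cases "u = 0") (auto intro!: add_nonneg_pos)
  have "ln (Gamma ((1 - u) * x + u * y)) \<le> (1 - u) * ln (Gamma x) + u * ln (Gamma y)"
    using convex_onD[OF log_convex_Gamma_real, of u x y] assms by simp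
  also have "\<dots> = ln (Gamma x powr (1 - u) * Gamma y powr u)"
    using assms by (simp add: ln_mult ln_powr Gamma_real_pos less_imp_neq[THEN not_sym])
  finally show ?thesis
    using pos Gamma_real_pos[OF assms(1)] Gamma_real_pos[OF assms(2)]
    by (subst (asm) ln_le_cancel_iff) auto
qed

lemma Gamma_plus1_pos: "Gamma (x + 1) = x * Gamma x" if "x > 0" for x :: real
  using that by (intro Gamma_plus1) (auto elim!: nonpos_Ints_cases)

text \<open>
  Interpolating between \<open>x\<close> and \<open>x + 1\<close> bounds \<open>\<Gamma>(x + a)\<close> from above. The lower bound below is the same
  estimate started at \<open>x + a\<close>, from which \<open>x + 1\<close> is reached by the complementary step \<open>1 - a\<close>.
  Together they are Wendel's inequalities.
\<close>

lemma Gamma_plus_le: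
  fixes x a :: real
  assumes "x > 0" "0 \<le> a" "a \<le> 1"
  shows "Gamma (x + a) \<le> x powr a * Gamma x"
proof -
  have "Gamma (x + a) \<le> Gamma x powr (1 - a) * Gamma (x + 1) powr a"
    using Gamma_log_convex_mult[of x "x + 1" a] assms by (simp add: algebra_simps)
  also have "\<dots> = x powr a * (Gamma x powr (1 - a) * Gamma x powr a)"
    using assms by (simp add: Gamma_plus1_pos powr_mult less_imp_neq[THEN not_sym] mult_ac)
  also have "Gamma x powr (1 - a) * Gamma x powr a = Gamma x"
    using assms Gamma_real_pos[of x] by (simp flip: powr_add)
  finally show ?thesis .
qed

lemma Gamma_plus_ge:
  fixes x a :: real
  assumes "x > 0" "0 \<le> a" "a \<le> 1"
  shows "x * Gamma x \<le> (x + a) powr (1 - a) * Gamma (x + a)"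
  using Gamma_plus_le[of "x + a" "1 - a"] assms by (simp add: Gamma_plus1_pos)

text \<open>
  Writing \<open>R\<close> for the quotient, Wendel's inequalities at \<open>s\<close> and at \<open>1 - s\<close> give
  \<open>R \<le> (1 + 1/x) * x powr (2 * s - 1)\<close> and \<open>x powr (2 * s - 1) \<le> (1 + 1/x) * R\<close>: the only loss is the
  factor \<open>(1 + v / x) powr (1 - v)\<close>, which is at most \<open>1 + 1/x\<close>.
\<close>

lemma Gamma_ratio_bounds:
  fixes x s :: real
  assumes "x > 0" "0 \<le> s" "s \<le> 1"
  shows "\<bar>Gamma (x + s) / Gamma (x + 1 - s) - x powr (2 * s - 1)\<bar> \<le> x powr (2 * s - 2)"
proof -
  define R where "R = Gamma (x + s) / Gamma (x + 1 - s)"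
  have pos: "Gamma x > 0" "Gamma (x + s) > 0" "Gamma (x + 1 - s) > 0"
    using assms by (auto intro!: Gamma_real_pos)
  have split: "x = x powr s * x powr (1 - s)"
    using assms by (simp flip: powr_add)
  have bern: "(1 + v / x) powr (1 - v) \<le> 1 + 1 / x" "(1 + v / x) powr (1 - v) > 0"
    if "0 \<le> v" "v \<le> 1" for v
  proof -
    have "(1 + v / x) powr (1 - v) \<le> (1 + v / x) powr 1"
      using that assms by (intro powr_mono) auto
    also have "\<dots> \<le> 1 + 1 / x"
      using that assms by (auto simp: divide_right_mono)
    finally show "(1 + v / x) powr (1 - v) \<le> 1 + 1 / x" .
    show "(1 + v / x) powr (1 - v) > 0"
      using that assms by (simp add: add_pos_nonneg less_imp_neq[THEN not_sym])
  qed
  have scale: "(x + v) powr (1 - v) = x powr (1 - v) * (1 + v / x) powr (1 - v)"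
    if "0 \<le> v" for v
  proof -
    have "x + v = x * (1 + v / x)" using assms by (simp add: field_simps)
    thus ?thesis using that assms by (simp only: powr_mult)
  qed
  have lower: "x powr v * Gamma x \<le> (1 + 1 / x) * Gamma (x + v)" if v: "0 \<le> v" "v \<le> 1" for v
  proof -
    have "x powr (1 - v) * (x powr v * Gamma x) = x * Gamma x"
      using assms by (simp flip: powr_add)
    also have "\<dots> \<le> x powr (1 - v) * ((1 + v / x) powr (1 - v) * Gamma (x + v))"
      using Gamma_plus_ge[of x v] assms v scale[of v] by (simp add: mult.assoc)
    also have "\<dots> \<le> x powr (1 - v) * ((1 + 1 / x) * Gamma (x + v))"
      using bern[of v] v assms
      by (intro mult_left_mono mult_right_mono) (auto intro!: less_imp_le[OF Gamma_real_pos])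
    finally show ?thesis using assms by simp
  qed
  have "R * (x powr (1 - s) * Gamma x) \<le> R * ((1 + 1 / x) * Gamma (x + 1 - s))"
    using lower[of "1 - s"] assms pos unfolding R_def
    by (intro mult_left_mono) (auto simp: algebra_simps)
  also have "\<dots> = (1 + 1 / x) * Gamma (x + s)"
    using pos(3) by (simp add: R_def mult.assoc)
  also have "\<dots> \<le> (1 + 1 / x) * (x powr s * Gamma x)"
    using assms Gamma_plus_le[of x s] by (intro mult_left_mono) auto
  finally have "R * x powr (1 - s) \<le> (1 + 1 / x) * x powr s"
    using pos by (simp add: mult.assoc [symmetric])
  hence "R \<le> (1 + 1 / x) * (x powr s / x powr (1 - s))"
    using assms by (simp add: field_simps)
  also have "x powr s / x powr (1 - s) = x powr (2 * s - 1)"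
    by (simp flip: powr_diff)
  finally have up: "R \<le> (1 + 1 / x) * x powr (2 * s - 1)" .
  have "x powr s * Gamma x \<le> (1 + 1 / x) * Gamma (x + s)"
    using lower[of s] assms by simp
  also have "\<dots> = (1 + 1 / x) * R * Gamma (x + (1 - s))"
    using pos(3) by (simp add: R_def add_diff_eq)
  also have "\<dots> \<le> (1 + 1 / x) * R * (x powr (1 - s) * Gamma x)"
    using assms Gamma_plus_le[of x "1 - s"] pos
    by (intro mult_left_mono) (auto simp: R_def)
  finally have "x powr s \<le> (1 + 1 / x) * R * x powr (1 - s)"
    using pos by (simp add: mult.assoc [symmetric])
  hence "x powr s / x powr (1 - s) \<le> (1 + 1 / x) * R"
    using assms by (simp add: field_simps)
  also have "x powr s / x powr (1 - s) = x powr (2 * s - 1)"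
    by (simp flip: powr_diff)
  finally have "x powr (2 * s - 1) \<le> (1 + 1 / x) * R" .
  hence low: "x * x powr (2 * s - 1) \<le> (x + 1) * R"
    using assms by (simp add: field_simps)
  have shift: "x powr (2 * s - 1) = x * x powr (2 * s - 2)"
    using assms powr_add[of x 1 "2 * s - 2"] by simp
  define q where "q = x powr (2 * s - 2)"
  have "q \<ge> 0" by (simp add: q_def)
  have "(1 + 1 / x) * (x * q) = x * q + q"
    using assms by (simp add: field_simps)
  hence "R \<le> x * q + q"
    using up unfolding shift q_def by simp
  moreover have "x * q - q \<le> R"
  proof -
    \<comment> \<open>This is \<open>1 - 1/x \<le> 1 / (1 + 1/x)\<close>, cleared of denominators.\<close>
    have "(x + 1) * (x * q - q) = x * (x * q) - q"
      by (simp add: algebra_simps)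
    also have "\<dots> \<le> (x + 1) * R"
      using low [unfolded shift, folded q_def] \<open>q \<ge> 0\<close> by simp
    finally show ?thesis using assms by simp
  qed
  ultimately show ?thesis
    unfolding shift R_def q_def by (simp add: abs_le_iff)
qed

section \<open>Gauss's summation theorem\<close>

text \<open>
  The binomial series of \<open>(1 - x) powr (- a)\<close>, with its coefficients written through \<open>\<Gamma>\<close> so that they
  are visibly positive.
\<close>

lemma Gamma_binomial_series:
  fixes a x :: real
  assumes "a > 0" "\<bar>x\<bar> < 1"
  shows "(\<lambda>k. Gamma (a + real k) / fact k * x ^ k) sums (Gamma a * (1 - x) powr (- a))"
proof -
  have "(\<lambda>k. Gamma a * ((- a gchoose k) * (- x) ^ k)) sums (Gamma a * (1 + - x) powr (- a))"
    using assms by (intro sums_mult gen_binomial_real) auto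
  moreover have "Gamma a * ((- a gchoose k) * (- x) ^ k) = Gamma (a + real k) / fact k * x ^ k" for k
  proof -
    have "a \<notin> \<int>\<^sub>\<le>\<^sub>0" using assms by (auto elim!: nonpos_Ints_cases)
    hence "pochhammer a k = Gamma (a + real k) / Gamma a"
      by (rule pochhammer_Gamma)
    moreover have "(- x) ^ k = (- 1) ^ k * x ^ k"
      by (subst power_mult_distrib [symmetric]) simp
    moreover have "(- 1) ^ k * (- 1) ^ k = (1 :: real)"
      by (simp flip: power_mult_distrib)
    ultimately show ?thesis
      using Gamma_real_pos[OF assms(1)] by (simp add: gbinomial_pochhammer)
  qed
  ultimately show ?thesis by simp
qed

lemma nn_integral_Beta:
  fixes a b :: real
  assumes "a > 0" "b > 0"
  shows "(\<integral>\<^sup>+t. ennreal (t powr (a - 1) * (1 - t) powr (b - 1)) * indicator {0<..<1} t \<partial>lborel)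
           = ennreal (Beta a b)"
  using has_integral_Beta_real[OF assms]
  by (intro nn_integral_has_integral_lebesgue') (auto simp: has_integral_Icc_iff_Ioo)

text \<open>
  Gauss's value of the hypergeometric function at 1, for positive parameters. Euler's integral writes
  \<open>\<Gamma>(b + k) \<Gamma>(c - b) / \<Gamma>(c + k)\<close> as the integral of \<open>t ^ k\<close> against the Beta weight
  \<open>t powr (b - 1) * (1 - t) powr (c - b - 1)\<close> on the unit interval. Under the integral sign the sum is
  a binomial series, which only lowers the exponent of \<open>1 - t\<close> by \<open>a\<close>, so that a Beta integral
  remains. Since everything is nonnegative, sum and integral may be exchanged in \<open>ennreal\<close>, and the
  finite value obtained there yields the convergence as well.
\<close>

theorem gauss_hypergeometric_sum:
  fixes a b c :: real
  assumes "a > 0" "b > 0" "a + b < c"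
  shows "(\<lambda>k. Gamma (a + real k) * Gamma (b + real k) / (fact k * Gamma (c + real k)))
           sums (Gamma a * Gamma b * Gamma (c - a - b) / (Gamma (c - a) * Gamma (c - b)))"
proof -
  define A where "A k = Gamma (a + real k) / fact k" for k
  define w where "w t = t powr (b - 1) * (1 - t) powr (c - b - 1)" for t :: real
  have A: "A k \<ge> 0" for k
    using assms by (auto simp: A_def intro!: divide_nonneg_pos less_imp_le[OF Gamma_real_pos])
  have Beta_pos: "Beta p q \<ge> 0" if "p > 0" "q > 0" for p q :: real
    using that by (auto simp: Beta_def intro!: divide_nonneg_nonneg mult_nonneg_nonneg less_imp_le[OF Gamma_real_pos])
  have "(\<Sum>k. ennreal (A k * Beta (b + real k) (c - b))) =
          (\<Sum>k. \<integral>\<^sup>+t. ennreal (A k * t ^ k * w t) * indicator {0<..<1} t \<partial>lborel)"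
  proof (intro suminf_cong)
    fix k
    have "ennreal (A k * Beta (b + real k) (c - b)) =
            ennreal (A k) * (\<integral>\<^sup>+t. ennreal (t powr (b + real k - 1) * (1 - t) powr (c - b - 1)) *
              indicator {0<..<1} t \<partial>lborel)"
      using assms A by (subst nn_integral_Beta) (auto simp: ennreal_mult' Beta_pos)
    also have "\<dots> = (\<integral>\<^sup>+t. ennreal (A k) * (ennreal (t powr (b + real k - 1) *
                          (1 - t) powr (c - b - 1)) * indicator {0<..<1} t) \<partial>lborel)"
      by (intro nn_integral_cmult [symmetric]) auto
    also have "\<dots> = (\<integral>\<^sup>+t. ennreal (A k * t ^ k * w t) * indicator {0<..<1} t \<partial>lborel)"
    proof (intro nn_integral_cong)
      fix t :: real
      have "t powr (b + real k - 1) = t ^ k * t powr (b - 1)" if "t > 0"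
        using that by (simp flip: powr_realpow powr_add add: algebra_simps)
      thus "ennreal (A k) * (ennreal (t powr (b + real k - 1) * (1 - t) powr (c - b - 1)) *
              indicator {0<..<1} t) = ennreal (A k * t ^ k * w t) * indicator {0<..<1} t"
        using A[of k] by (auto simp: indicator_def w_def mult_ac simp flip: ennreal_mult')
    qed
    finally show "ennreal (A k * Beta (b + real k) (c - b)) =
      (\<integral>\<^sup>+t. ennreal (A k * t ^ k * w t) * indicator {0<..<1} t \<partial>lborel)" .
  qed
  also have "\<dots> = (\<integral>\<^sup>+t. (\<Sum>k. ennreal (A k * t ^ k * w t) * indicator {0<..<1} t) \<partial>lborel)"
    by (intro nn_integral_suminf [symmetric]) (auto simp: w_def)
  also have "\<dots> = (\<integral>\<^sup>+t. ennreal (Gamma a) * (ennreal (t powr (b - 1) *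
                     (1 - t) powr (c - a - b - 1)) * indicator {0<..<1} t) \<partial>lborel)"
  proof (intro nn_integral_cong)
    fix t :: real
    show "(\<Sum>k. ennreal (A k * t ^ k * w t) * indicator {0<..<1} t) =
            ennreal (Gamma a) * (ennreal (t powr (b - 1) * (1 - t) powr (c - a - b - 1)) *
              indicator {0<..<1} t)"
    proof (cases "t \<in> {0<..<1}")
      case True
      have "(\<lambda>k. A k * t ^ k * w t) sums (Gamma a * (1 - t) powr (- a) * w t)"
        unfolding A_def using True assms by (intro sums_mult2 Gamma_binomial_series) auto
      also have "Gamma a * (1 - t) powr (- a) * w t =
                   Gamma a * (t powr (b - 1) * (1 - t) powr (c - a - b - 1))"
        using True by (simp add: w_def mult_ac flip: powr_add) (simp add: algebra_simps)
      finally have "(\<Sum>k. ennreal (A k * t ^ k * w t)) =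
          ennreal (Gamma a * (t powr (b - 1) * (1 - t) powr (c - a - b - 1)))"
        using True A by (intro suminf_ennreal_eq) (auto simp: w_def)
      thus ?thesis using True assms
        by (simp add: ennreal_mult' Gamma_real_pos less_imp_le)
    qed auto
  qed
  also have "\<dots> = ennreal (Gamma a) * ennreal (Beta b (c - a - b))"
    using assms by (subst nn_integral_cmult) (auto simp: nn_integral_Beta)
  also have "\<dots> = ennreal (Gamma a * Beta b (c - a - b))"
    using assms by (simp add: ennreal_mult' Gamma_real_pos less_imp_le)
  finally have *: "(\<Sum>k. ennreal (A k * Beta (b + real k) (c - b))) = ennreal (Gamma a * Beta b (c - a - b))" .
  have nonneg: "A k * Beta (b + real k) (c - b) \<ge> 0" for k
    using assms A by (intro mult_nonneg_nonneg Beta_pos) auto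
  have "(\<lambda>k. ennreal (A k * Beta (b + real k) (c - b))) sums ennreal (Gamma a * Beta b (c - a - b))"
    using * by (simp add: sums_iff)
  hence "(\<lambda>k. A k * Beta (b + real k) (c - b)) sums (Gamma a * Beta b (c - a - b))"
    using assms nonneg by (subst (asm) sums_ennreal) (auto intro!: mult_nonneg_nonneg Beta_pos less_imp_le[OF Gamma_real_pos])
  hence "(\<lambda>k. A k * Beta (b + real k) (c - b) / Gamma (c - b)) sums (Gamma a * Beta b (c - a - b) / Gamma (c - b))"
    by (rule sums_divide)
  moreover have "Gamma (c - b) > 0"
    using assms by (intro Gamma_real_pos) auto
  ultimately show ?thesis
    by (simp add: A_def Beta_def mult_ac add_ac)
qed

section \<open>The power series of the Bessel functions\<close>

lemma bessel_I_terms_summable: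
  fixes x :: real
  shows "summable (\<lambda>k. (x / 2) ^ (2 * k + n) / (fact k * fact (k + n)))"
proof (rule summable_comparison_test)
  show "\<exists>N. \<forall>k\<ge>N. norm ((x / 2) ^ (2 * k + n) / (fact k * fact (k + n))) \<le>
          \<bar>x / 2\<bar> ^ n * (inverse (fact k) * ((x / 2)\<^sup>2) ^ k)"
  proof (intro exI allI impI)
    fix k :: nat
    have "\<bar>x / 2\<bar> ^ (2 * k + n) / (fact k * fact (k + n)) \<le> \<bar>x / 2\<bar> ^ (2 * k + n) / (fact k * 1)"
      by (intro divide_left_mono mult_left_mono) (auto simp: fact_ge_1)
    also have "\<dots> = \<bar>x / 2\<bar> ^ (2 * k + n) * inverse (fact k)"
      by (simp only: mult_1_right divide_inverse)
    also have "\<dots> = \<bar>x / 2\<bar> ^ n * (inverse (fact k) * ((x / 2)\<^sup>2) ^ k)"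
    proof -
      have "\<bar>x / 2\<bar> ^ (2 * k + n) = \<bar>x / 2\<bar> ^ n * ((x / 2)\<^sup>2) ^ k"
        by (simp only: power_add power_mult power2_abs) (simp only: mult.commute)
      thus ?thesis by (simp only: mult_ac)
    qed
    finally have "\<bar>x / 2\<bar> ^ (2 * k + n) / (fact k * fact (k + n)) \<le>
        \<bar>x / 2\<bar> ^ n * (inverse (fact k) * ((x / 2)\<^sup>2) ^ k)" .
    moreover have "norm ((x / 2) ^ (2 * k + n) / (fact k * fact (k + n))) =
        \<bar>x / 2\<bar> ^ (2 * k + n) / (fact k * fact (k + n))"
      by (simp only: norm_divide norm_power norm_mult norm_fact) simp
    ultimately show "norm ((x / 2) ^ (2 * k + n) / (fact k * fact (k + n))) \<le>
        \<bar>x / 2\<bar> ^ n * (inverse (fact k) * ((x / 2)\<^sup>2) ^ k)"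
      by (simp only:)
  qed
  show "summable (\<lambda>k. \<bar>x / 2\<bar> ^ n * (inverse (fact k) * ((x / 2)\<^sup>2) ^ k))"
    by (intro summable_mult summable_exp)
qed

text \<open>
  The factorial form of the series, covering both signs of the order at once. For negative order
  \<open>-n\<close> the first \<open>n\<close> terms of the defining series vanish, and shifting the index by \<open>n\<close>
  gives the series for \<open>n\<close>; this is the symmetry of \<open>I\<^sub>m\<close> in \<open>m\<close>.
\<close>

lemma bessel_I_sums:
  fixes x :: real
  shows "(\<lambda>k. (x / 2) ^ (2 * k + nat \<bar>m\<bar>) / (fact k * fact (k + nat \<bar>m\<bar>))) sums bessel_I m x"
proof -
  define n where "n = nat \<bar>m\<bar>"
  define f where "f = (\<lambda>k. rGamma (of_int (int k + m + 1)) / fact k * (x / 2) powi (2 * int k + m))"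
  define g where "g = (\<lambda>k. (x / 2) ^ (2 * k + n) / (fact k * fact (k + n)))"
  have g: "g sums suminf g"
    unfolding g_def by (intro summable_sums bessel_I_terms_summable)
  have "f sums suminf g"
  proof (cases "m \<ge> 0")
    case True
    hence m: "m = int n" by (simp add: n_def)
    have "f k = g k" for k
    proof -
      have "rGamma (of_int (int k + m + 1)) = (1 :: real) / fact (k + n)"
        unfolding rGamma_of_int by (simp add: m nat_add_distrib field_simps)
      moreover have "2 * int k + m = int (2 * k + n)" by (simp add: m)
      ultimately show ?thesis
        unfolding f_def g_def by (simp only: power_int_of_nat) simp
    qed
    hence "f = g" by auto
    with g show ?thesis by simp
  next
    case False
    hence m: "m = - int n" by (simp add: n_def)
    have zero: "f k = 0" if "k < n" for k
      using that unfolding f_def rGamma_of_int by (auto simp: m)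
    have "f (k + n) = g k" for k
    proof -
      have "rGamma (of_int (int (k + n) + m + 1)) = (1 :: real) / fact k"
        unfolding rGamma_of_int by (simp add: m field_simps)
      moreover have "2 * int (k + n) + m = int (2 * k + n)" by (simp add: m)
      ultimately show ?thesis
        unfolding f_def g_def by (simp only: power_int_of_nat) simp
    qed
    hence "(\<lambda>k. f (k + n)) sums suminf g" using g by simp
    thus ?thesis using zero by (subst (asm) sums_zero_iff_shift) auto
  qed
  moreover have "bessel_I m x = suminf f" by (simp add: bessel_I_def f_def)
  ultimately have "bessel_I m x = suminf g" by (simp add: sums_iff)
  with g show ?thesis by (simp add: g_def n_def)
qed

lemma borel_measurable_bessel_I [measurable]: "bessel_I m \<in> borel_measurable borel"
proof -
  have "bessel_I m = (\<lambda>x. \<Sum>k. (x / 2) ^ (2 * k + nat \<bar>m\<bar>) / (fact k * fact (k + nat \<bar>m\<bar>)))"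
    using bessel_I_sums[of _ m] by (auto simp: sums_iff)
  thus ?thesis by simp
qed

section \<open>The kernel\<close>

lemma nn_integral_Gamma_scaled:
  fixes p r :: real
  assumes "p > 0" "r > 0"
  shows "(\<integral>\<^sup>+t. ennreal (exp (- (r * t)) * t powr (p - 1)) * indicator {0<..} t \<partial>lborel) =
           ennreal (Gamma p / r powr p)"
proof -
  let ?f = "\<lambda>t. ennreal (indicator {0..} t * t powr (p - 1) / exp t)"
  have "ennreal (Gamma p) = (\<integral>\<^sup>+t. ?f t \<partial>lborel)"
    by (rule Gamma_conv_nn_integral_real) fact
  also have "\<dots> = ennreal r * (\<integral>\<^sup>+t. ?f (0 + r * t) \<partial>lborel)"
    using assms by (subst nn_integral_real_affine[where c = r and t = 0]) auto
  also have "(\<integral>\<^sup>+t. ?f (0 + r * t) \<partial>lborel) =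
      (\<integral>\<^sup>+t. ennreal (r powr (p - 1)) * (ennreal (exp (- (r * t)) * t powr (p - 1)) * indicator {0<..} t) \<partial>lborel)"
  proof (intro nn_integral_cong)
    fix t :: real
    have "0 \<le> r * t \<longleftrightarrow> 0 \<le> t" using assms by (simp add: zero_le_mult_iff)
    thus "?f (0 + r * t) = ennreal (r powr (p - 1)) *
            (ennreal (exp (- (r * t)) * t powr (p - 1)) * indicator {0<..} t)"
      using assms by (auto simp: indicator_def powr_mult exp_minus field_simps simp flip: ennreal_mult')
  qed
  also have "\<dots> = ennreal (r powr (p - 1)) *
      (\<integral>\<^sup>+t. ennreal (exp (- (r * t)) * t powr (p - 1)) * indicator {0<..} t \<partial>lborel)"
    (is "_ = _ * ?I") by (subst nn_integral_cmult) auto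
  finally have "ennreal (Gamma p) = ennreal r * (ennreal (r powr (p - 1)) * ?I)" .
  also have "\<dots> = ennreal (r * r powr (p - 1)) * ?I"
    using assms by (simp add: ennreal_mult' mult.assoc)
  also have "r * r powr (p - 1) = r powr p"
    using assms powr_add[of r 1 "p - 1"] by simp
  finally have *: "ennreal (Gamma p) = ennreal (r powr p) * ?I" .
  have "ennreal (Gamma p / r powr p) = ennreal (1 / r powr p) * ennreal (Gamma p)"
    by (simp flip: ennreal_mult')
  also have "\<dots> = ennreal (1 / r powr p * r powr p) * ?I"
    unfolding * by (subst ennreal_mult') (auto simp: mult.assoc)
  also have "1 / r powr p * r powr p = 1" using assms by simp
  finally show ?thesis by simp
qed

text \<open>
  The \<open>k\<close>-th term is the integral of \<open>exp (- 2 * t) * t powr (s - 1)\<close> against the \<open>k\<close>-th term of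
  \<open>I\<^sub>m(2t)\<close>. After duplication, Gauss's theorem applies with \<open>a = (N + s) / 2\<close>, \<open>b = a + 1/2\<close> and
  \<open>c = N + 1\<close>.
\<close>

lemma frac_kernel_series_sums:
  fixes s :: real and m :: int
  assumes "0 < s" "s < 1 / 2"
  defines "N \<equiv> real_of_int \<bar>m\<bar>"
  shows "(\<lambda>k. Gamma (2 * real k + N + s) / (2 powr (2 * real k + N + s) * (fact k * fact (k + nat \<bar>m\<bar>))))
           sums (4 powr (- s) * Gamma (1 / 2 - s) * Gamma (N + s) / (sqrt pi * Gamma (N + 1 - s)))"
proof -
  have N: "N \<ge> 0" "real (nat \<bar>m\<bar>) = N" by (auto simp: N_def)
  define a where "a = (N + s) / 2"
  have a: "a > 0" using assms(1) N by (simp add: a_def)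
  \<comment> \<open>Duplication at \<open>k + a\<close> leaves the factor \<open>2 * sqrt pi\<close>.\<close>
  have "(\<lambda>k. 1 / (2 * sqrt pi) * (Gamma (a + real k) * Gamma (a + 1 / 2 + real k) / (fact k * Gamma (N + 1 + real k))))
      sums (1 / (2 * sqrt pi) * (Gamma a * Gamma (a + 1 / 2) * Gamma (N + 1 - a - (a + 1 / 2)) /
                  (Gamma (N + 1 - a) * Gamma (N + 1 - (a + 1 / 2)))))" (is "?F sums ?S")
    using assms N a by (intro sums_mult gauss_hypergeometric_sum) (auto simp: a_def field_simps)
  moreover have "?F k = Gamma (2 * real k + N + s) /
      (2 powr (2 * real k + N + s) * (fact k * fact (k + nat \<bar>m\<bar>)))" for k
  proof -
    have "Gamma (a + real k) * Gamma (a + 1 / 2 + real k) =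
        2 powr (1 - 2 * (a + real k)) * sqrt pi * Gamma (2 * (a + real k))"
      using Gamma_legendre_duplication_real[of "a + real k"] a by (simp add: add_ac)
    moreover have "2 * (a + real k) = 2 * real k + N + s" by (simp add: a_def)
    moreover have "2 powr (1 - x) = 2 / (2 powr x)" for x :: real
      by (simp add: powr_diff)
    moreover have "Gamma (N + 1 + real k) = fact (k + nat \<bar>m\<bar>)"
      using Gamma_fact[of "k + nat \<bar>m\<bar>", where 'a = real] N(2) by (simp add: add_ac)
    ultimately show ?thesis by (simp add: field_simps)
  qed
  moreover have "?S = 4 powr (- s) * Gamma (1 / 2 - s) * Gamma (N + s) / (sqrt pi * Gamma (N + 1 - s))"
  proof -
    have num: "Gamma a * Gamma (a + 1 / 2) = 2 powr (1 - (N + s)) * sqrt pi * Gamma (N + s)"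
    proof -
      have "2 * a = N + s" by (simp add: a_def)
      thus ?thesis using Gamma_legendre_duplication_real[OF a] by (simp only:)
    qed
    \<comment> \<open>The arguments \<open>c - b = (N + 1 - s) / 2\<close> and \<open>c - a\<close> again differ by \<open>1/2\<close>.\<close>
    have "Gamma (N + 1 - (a + 1 / 2)) * Gamma (N + 1 - a) =
        2 powr (1 - (N + 1 - s)) * sqrt pi * Gamma (N + 1 - s)"
    proof -
      have "N + 1 - (a + 1 / 2) = (N + 1 - s) / 2" "N + 1 - a = (N + 1 - s) / 2 + 1 / 2"
        by (simp_all add: a_def field_simps)
      moreover have "(N + 1 - s) / 2 > 0" "2 * ((N + 1 - s) / 2) = N + 1 - s"
        using N assms(2) by auto
      ultimately show ?thesis
        using Gamma_legendre_duplication_real[of "(N + 1 - s) / 2"] by (simp only:)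
    qed
    hence den: "Gamma (N + 1 - a) * Gamma (N + 1 - (a + 1 / 2)) =
        2 powr (s - N) * sqrt pi * Gamma (N + 1 - s)" by (simp add: mult_ac)
    have "2 powr (1 - (N + s)) = 2 * 4 powr (- s) * 2 powr (s - N)"
    proof -
      have "(4 :: real) powr (- s) = 2 powr (- 2 * s)"
        using powr_powr[of 2 2 "- s"] by simp
      hence "2 * 4 powr (- s) * 2 powr (s - N) = 2 powr 1 * 2 powr (- 2 * s) * 2 powr (s - N)"
        by simp
      also have "\<dots> = 2 powr (1 - (N + s))"
        unfolding powr_add [symmetric] by (simp add: algebra_simps)
      finally show ?thesis by simp
    qed
    moreover have "N + 1 - a - (a + 1 / 2) = 1 / 2 - s" by (simp add: a_def field_simps)
    ultimately show ?thesis
      unfolding num den by (simp only:) simp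
  qed
  ultimately show ?thesis by simp
qed

text \<open>
  The integral is computed in \<open>ennreal\<close>, where termwise integration of a nonnegative series needs
  no further justification, and transferred to the Bochner integral by the nonnegativity of the integrand.
\<close>

lemma frac_kernel_eq:
  fixes s :: real
  assumes "0 < s" "s < 1 / 2"
  shows "frac_kernel s m = 4 powr (- s) * Gamma (1 / 2 - s) * Gamma (of_int \<bar>m\<bar> + s) /
           (sqrt pi * Gamma s * Gamma (of_int \<bar>m\<bar> + 1 - s))"
proof -
  define n where "n = nat \<bar>m\<bar>"
  define S where "S = 4 powr (- s) * Gamma (1 / 2 - s) * Gamma (of_int \<bar>m\<bar> + s) / (sqrt pi * Gamma (of_int \<bar>m\<bar> + 1 - s))"
  have n: "real_of_int \<bar>m\<bar> = real n" by (simp add: n_def)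
  define e where "e t = exp (- (2 * t)) * t powr (s - 1)" for t :: real
  define T where "T k = Gamma (2 * real k + real n + s) / (2 powr (2 * real k + real n + s) * (fact k * fact (k + n)))" for k
  have T: "T sums S"
    using frac_kernel_series_sums[OF assms, of m] by (simp add: T_def [abs_def] S_def n n_def)
  have T_nonneg: "T k \<ge> 0" for k
    unfolding T_def using assms
    by (intro divide_nonneg_pos mult_pos_pos less_imp_le[OF Gamma_real_pos]) auto
  have S_nonneg: "S \<ge> 0"
    using T T_nonneg by (auto simp: sums_iff intro: suminf_nonneg)
  have expand: "(\<lambda>k. t ^ (2 * k + n) / (fact k * fact (k + n)) * e t) sums
      (exp (- (2 * t)) * bessel_I m (2 * t) / t powr (1 - s))" if "t > 0" for t
  proof -
    have "(\<lambda>k. t ^ (2 * k + n) / (fact k * fact (k + n)) * e t) sums (bessel_I m (2 * t) * e t)"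
      using bessel_I_sums[of "2 * t" m] by (intro sums_mult2) (simp add: n_def)
    also have "bessel_I m (2 * t) * e t = exp (- (2 * t)) * bessel_I m (2 * t) / t powr (1 - s)"
      using powr_minus_divide[of t "1 - s"] by (simp add: e_def)
    finally show ?thesis .
  qed
  have [measurable]: "e \<in> borel_measurable borel"
    unfolding e_def by measurable
  have e_nonneg: "e t \<ge> 0" for t by (simp add: e_def)
  define F where "F t = indicator {0<..} t * (exp (- (2 * t)) * bessel_I m (2 * t) / t powr (1 - s))" for t
  have F_nonneg: "F t \<ge> 0" for t
  proof (cases "t > 0")
    case True
    have "0 \<le> exp (- (2 * t)) * bessel_I m (2 * t) / t powr (1 - s)"
      using True e_nonneg[of t] by (intro sums_le[OF _ sums_zero expand]) auto
    thus ?thesis unfolding F_def by (intro mult_nonneg_nonneg) auto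
  qed (simp add: F_def)
  have F_meas [measurable]: "F \<in> borel_measurable borel"
    unfolding F_def by measurable
  have term_int: "(\<integral>\<^sup>+t. ennreal (t ^ (2 * k + n) / (fact k * fact (k + n)) * e t) * indicator {0<..} t \<partial>lborel)
      = ennreal (T k)" for k
  proof -
    define c :: real where "c = 1 / (fact k * fact (k + n))"
    define p where "p = 2 * real k + real n + s"
    have c: "c \<ge> 0" by (simp add: c_def)
    have p: "p > 0" using assms by (simp add: p_def)
    have "(\<integral>\<^sup>+t. ennreal (t ^ (2 * k + n) / (fact k * fact (k + n)) * e t) * indicator {0<..} t \<partial>lborel) =
          (\<integral>\<^sup>+t. ennreal c * (ennreal (exp (- (2 * t)) * t powr (p - 1)) * indicator {0<..} t) \<partial>lborel)"
    proof (intro nn_integral_cong)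
      fix t :: real
      have "t ^ (2 * k + n) * t powr (s - 1) = t powr (p - 1)" if "t > 0"
        using that by (simp add: p_def algebra_simps flip: powr_realpow powr_add)
      hence "t ^ (2 * k + n) / (fact k * fact (k + n)) * e t = c * (exp (- (2 * t)) * t powr (p - 1))" if "t > 0"
        using that by (simp add: c_def e_def mult_ac)
      thus "ennreal (t ^ (2 * k + n) / (fact k * fact (k + n)) * e t) * indicator {0<..} t =
              ennreal c * (ennreal (exp (- (2 * t)) * t powr (p - 1)) * indicator {0<..} t)"
        using c by (auto simp: indicator_def ennreal_mult')
    qed
    also have "\<dots> = ennreal c * ennreal (Gamma p / 2 powr p)"
      using p nn_integral_Gamma_scaled[of p 2] by (subst nn_integral_cmult) auto
    also have "\<dots> = ennreal (T k)"
      using c by (simp add: T_def p_def c_def mult_ac flip: ennreal_mult')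
    finally show ?thesis .
  qed
  have "(\<integral>\<^sup>+t. ennreal (F t) \<partial>lborel) =
      (\<integral>\<^sup>+t. (\<Sum>k. ennreal (t ^ (2 * k + n) / (fact k * fact (k + n)) * e t) * indicator {0<..} t) \<partial>lborel)"
  proof (intro nn_integral_cong)
    fix t :: real
    show "ennreal (F t) =
        (\<Sum>k. ennreal (t ^ (2 * k + n) / (fact k * fact (k + n)) * e t) * indicator {0<..} t)"
    proof (cases "t > 0")
      case True
      have "(\<Sum>k. ennreal (t ^ (2 * k + n) / (fact k * fact (k + n)) * e t)) =
          ennreal (exp (- (2 * t)) * bessel_I m (2 * t) / t powr (1 - s))"
        by (rule suminf_ennreal_eq[OF _ expand[OF True]]) (use True e_nonneg[of t] in simp)
      thus ?thesis using True by (simp only: F_def) simp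
    qed (auto simp: F_def)
  qed
  also have "\<dots> = (\<Sum>k. ennreal (T k))"
    by (subst nn_integral_suminf) (measurable, simp only: term_int)
  also have "\<dots> = ennreal S"
    by (intro suminf_ennreal_eq T T_nonneg)
  finally have "integral\<^sup>L lborel F = S"
    using F_nonneg S_nonneg by (subst integral_eq_nn_integral) auto
  hence "frac_kernel s m = 1 / Gamma s * S"
    unfolding frac_kernel_def set_lebesgue_integral_def F_def by simp
  thus ?thesis by (simp add: S_def mult_ac)
qed

theorem theorem4p1:
  fixes s :: real
  assumes "0 < s" and "s < 1 / 2"
  shows "(\<forall>m::int. m \<noteq> 0 \<longrightarrow>
            frac_kernel s m =
              4 powr (- s) * Gamma (1 / 2 - s) * Gamma (of_int \<bar>m\<bar> + s) /
                (sqrt pi * Gamma s * Gamma (of_int \<bar>m\<bar> + 1 - s)))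
       \<and> frac_kernel s 0 = 4 powr (- s) * Gamma (1 / 2 - s) / (sqrt pi * Gamma (1 - s))
       \<and> (\<exists>C>0. \<forall>m::int. m \<noteq> 0 \<longrightarrow>
            \<bar>frac_kernel s m - frac_const s / of_int \<bar>m\<bar> powr (1 - 2 * s)\<bar>
              \<le> C / of_int \<bar>m\<bar> powr (2 - 2 * s))"
proof (intro conjI)
  show "\<forall>m::int. m \<noteq> 0 \<longrightarrow> frac_kernel s m =
          4 powr (- s) * Gamma (1 / 2 - s) * Gamma (of_int \<bar>m\<bar> + s) /
            (sqrt pi * Gamma s * Gamma (of_int \<bar>m\<bar> + 1 - s))"
    using frac_kernel_eq[OF assms] by blast
  show "frac_kernel s 0 = 4 powr (- s) * Gamma (1 / 2 - s) / (sqrt pi * Gamma (1 - s))"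
    using frac_kernel_eq[OF assms, of 0] Gamma_real_pos[OF assms(1)] by simp
  have const_pos: "frac_const s > 0"
    unfolding frac_const_def using assms by (simp add: Gamma_real_pos)
  have "\<bar>frac_kernel s m - frac_const s / of_int \<bar>m\<bar> powr (1 - 2 * s)\<bar>
          \<le> frac_const s / of_int \<bar>m\<bar> powr (2 - 2 * s)" if "m \<noteq> 0" for m :: int
  proof -
    define x where "x = real_of_int \<bar>m\<bar>"
    define d where "d = Gamma (x + s) / Gamma (x + 1 - s) - x powr (2 * s - 1)"
    have "x > 0" using that by (simp add: x_def)
    hence "\<bar>d\<bar> \<le> x powr (2 * s - 2)"
      unfolding d_def using assms by (intro Gamma_ratio_bounds) auto
    hence "frac_const s * \<bar>d\<bar> \<le> frac_const s * x powr (2 * s - 2)"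
      using const_pos by (intro mult_left_mono) auto
    moreover have "frac_kernel s m - frac_const s / x powr (1 - 2 * s) = frac_const s * d"
      unfolding frac_kernel_eq[OF assms] d_def frac_const_def x_def [symmetric]
      using powr_minus_divide[of x "1 - 2 * s"] by (simp add: algebra_simps)
    moreover have "x powr (2 * s - 2) = 1 / x powr (2 - 2 * s)"
      using powr_minus_divide[of x "2 - 2 * s"] by simp
    ultimately have "\<bar>frac_kernel s m - frac_const s / x powr (1 - 2 * s)\<bar>
        \<le> frac_const s / x powr (2 - 2 * s)"
      using const_pos by (simp only: abs_mult) simp
    thus ?thesis by (simp only: x_def)
  qed
  with const_pos show "\<exists>C>0. \<forall>m::int. m \<noteq> 0 \<longrightarrow>
      \<bar>frac_kernel s m - frac_const s / of_int \<bar>m\<bar> powr (1 - 2 * s)\<bar>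
        \<le> C / of_int \<bar>m\<bar> powr (2 - 2 * s)"
    by blast
qed

end
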